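(* Let $\mathbb{X}=[X_1\rightrightarrows X_0]$ and $\mathbb{Y}=[Y_1\rightrightarrows Y_0]$ be Lie groupoids equipped with integrable connections $\mathcal{H}_X\subseteq TX_1$ and $\mathcal{H}_Y\subseteq TY_1$ respectively, and let $(F_1,F_0)\colon[X_1\rightrightarrows X_0]\to[Y_1\rightrightarrows Y_0]$ be a morphism of Lie groupoids compatible with the connections $\mathcal{H}_X$ and $\mathcal{H}_Y$. Let $\omega$ be a differential $k$-form on $Y_0$, and $F_0^*\omega$ the pull-back of $\omega$ along $F_0\colon X_0\to Y_0$. Suppose further that $F_1\colon X_1\to Y_1$ is a surjective submersion. If $F_0^*\omega$ is a $k$-form on $(\mathbb{X},\mathcal{H}_X)$, then $\omega$ is a $k$-form on $(\mathbb{Y},\mathcal{H}_Y)$.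
   Context: A Lie groupoid $[X_1\rightrightarrows X_0]$ is a groupoid with smooth manifolds of objects $X_0$ and arrows $X_1$, smooth structure maps, and submersive source and target maps $s,t\colon X_1\to X_0$; $e\colon X_0\to X_1$, $a\mapsto 1_a$, is the unit map; a morphism of Lie groupoids is a smooth functor. A connection on $[X_1\rightrightarrows X_0]$ is a sub-bundle $\mathcal{H}\subseteq TX_1$ with $T_\gamma X_1=\mathcal{H}_\gamma X_1\oplus\ker(s_{*,\gamma})$ for all $\gamma\in X_1$ such that, writing $\theta_\gamma=t_{*,\gamma}\circ(s_{*,\gamma}|_{\mathcal{H}_\gamma X_1})^{-1}\colon T_{s(\gamma)}X_0\to T_{t(\gamma)}X_0$, one has (1) $\theta_{\gamma\circ\gamma'}=\theta_\gamma\circ\theta_{\gamma'}$ for all composable $\gamma,\gamma'$, and (2) $e_{*,a}(T_aX_0)=\mathcal{H}_{1_a}$ for all $a\in X_0$. It is integrable if the Lie bracket of any two vector fields on $X_1$ with values in $\mathcal{H}$ has values in $\mathcal{H}$. For $v\in T_\gamma X_1$, $\mathcal{H}_\gamma(v)$ denotes the component of $v$ in $\mathcal{H}_\gamma X_1$. For a differential $k$-form $\eta$ on $X_1$, $\mathcal{H}(\eta)$ is the $k$-form $\mathcal{H}(\eta)(\gamma)(v_1,\dots,v_k)=\eta(\gamma)(\mathcal{H}_\gamma(v_1),\dots,\mathcal{H}_\gamma(v_k))$. A differential $k$-form on $(\mathbb{X},\mathcal{H})$ is a differential $k$-form $\omega$ on the manifold $X_0$ such that $\mathcal{H}(s^*\omega)=\mathcal{H}(t^*\omega)$.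 A morphism $(F_1,F_0)$ is compatible with the connections $\mathcal{H}_X,\mathcal{H}_Y$ if $(F_1)_{*,\gamma}$ sends the $\mathcal{H}_X$-horizontal component of $v$ to the $\mathcal{H}_Y$-horizontal component of $(F_1)_{*,\gamma}(v)$, for all $\gamma\in X_1$ and $v\in T_\gamma X_1$. *)

theory Defs
  imports "HOL-Analysis.Analysis" "HOL-Library.Function_Algebras"
begin

section \<open>The pointwise real vector space structure on functions\<close>

instantiation "fun" :: (type, real_vector) real_vector
begin

definition scaleR_fun :: "real \<Rightarrow> ('a \<Rightarrow> 'b) \<Rightarrow> 'a \<Rightarrow> 'b" where
  "scaleR_fun c f = (\<lambda>x. c *\<^sub>R f x)"

instance
  by standard (simp_all add: scaleR_fun_def fun_eq_iff scaleR_add_right scaleR_add_left)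

end


section \<open>Smooth manifolds\<close>

text \<open>
  \<open>smooth_on S f\<close> says that \<open>f\<close> is \<open>C\<^sup>\<infinity>\<close> on \<open>S\<close>; it is only used for open subsets of
  finite-dimensional spaces. There \<open>Ck_on k S f\<close> is the usual notion of class \<open>C\<^sup>k\<close>, stated
  through the directional derivatives of \<open>f\<close>.
\<close>

primrec Ck_on ::
  "nat \<Rightarrow> 'e::real_normed_vector set \<Rightarrow> ('e \<Rightarrow> 'f::real_normed_vector) \<Rightarrow> bool" where
  "Ck_on 0 S f \<longleftrightarrow> continuous_on S f"
| "Ck_on (Suc k) S f \<longleftrightarrow>
     (\<forall>x\<in>S. f differentiable (at x)) \<and>
     (\<forall>v. Ck_on k S (\<lambda>x. frechet_derivative f (at x) v))"

definition smooth_on ::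
  "'e::real_normed_vector set \<Rightarrow> ('e \<Rightarrow> 'f::real_normed_vector) \<Rightarrow> bool" where
  "smooth_on S f \<longleftrightarrow> (\<forall>k. Ck_on k S f)"

text \<open>
  Manifolds are modelled on a finite-dimensional real inner product space \<open>'e\<close>, i.e. on
  \<open>\<real>\<^sup>n\<close> with \<open>n = dim 'e\<close>. The class \<open>real_inner\<close> is used rather than \<open>euclidean_space\<close>, since the
  latter excludes \<open>n = 0\<close> (and with it, for instance, Lie groups viewed as Lie groupoids over a
  point). A chart is a pair of its domain and a map that is relevant on this domain only.
\<close>

record ('a, 'e) manifold =
  mtop :: "'a topology"
  atlas :: "('a set \<times> ('a \<Rightarrow> 'e)) set"

abbreviation carr :: "('a, 'e, 'z) manifold_scheme \<Rightarrow> 'a set" where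
  "carr M \<equiv> topspace (mtop M)"

definition smooth_manifold :: "('a, 'e::real_inner) manifold \<Rightarrow> bool" where
  "smooth_manifold M \<longleftrightarrow>
     (\<exists>B::'e set. finite B \<and> span B = UNIV) \<and>
     Hausdorff_space (mtop M) \<and>
     second_countable (mtop M) \<and>
     (\<forall>(U, \<phi>) \<in> atlas M.
        openin (mtop M) U \<and>
        open (\<phi> ` U) \<and>
        homeomorphic_map (subtopology (mtop M) U) (top_of_set (\<phi> ` U)) \<phi>) \<and>
     (\<Union>(U, \<phi>) \<in> atlas M. U) = carr M \<and>
     (\<forall>(U, \<phi>) \<in> atlas M. \<forall>(V, \<psi>) \<in> atlas M.
        smooth_on (\<phi> ` (U \<inter> V)) (\<psi> \<circ> inv_into U \<phi>))"

definition smooth_map ::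
  "('a, 'e::real_inner) manifold \<Rightarrow> ('b, 'f::real_inner) manifold \<Rightarrow> ('a \<Rightarrow> 'b) \<Rightarrow> bool" where
  "smooth_map M N f \<longleftrightarrow>
     continuous_map (mtop M) (mtop N) f \<and>
     (\<forall>(U, \<phi>) \<in> atlas M. \<forall>(V, \<psi>) \<in> atlas N.
        smooth_on (\<phi> ` (U \<inter> f -` V)) (\<psi> \<circ> f \<circ> inv_into U \<phi>))"

definition real_line :: "(real, real) manifold" where
  "real_line = \<lparr>mtop = euclidean, atlas = {(UNIV, id)}\<rparr>"

definition smooth_functions :: "('a, 'e::real_inner) manifold \<Rightarrow> ('a \<Rightarrow> real) set" where
  "smooth_functions M = {f. smooth_map M real_line f}"

definition open_submanifold :: "('a, 'e::real_inner) manifold \<Rightarrow> 'a set \<Rightarrow> ('a, 'e) manifold" where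
  "open_submanifold M W =
     \<lparr>mtop = subtopology (mtop M) W, atlas = (\<lambda>(U, \<phi>). (U \<inter> W, \<phi>)) ` atlas M\<rparr>"

definition prod_manifold ::
  "('a, 'e::real_inner) manifold \<Rightarrow> ('b, 'f::real_inner) manifold \<Rightarrow> ('a \<times> 'b, 'e \<times> 'f) manifold"
  where
  "prod_manifold M N =
     \<lparr>mtop = prod_topology (mtop M) (mtop N),
      atlas = {(U \<times> V, map_prod \<phi> \<psi>) | U \<phi> V \<psi>. (U, \<phi>) \<in> atlas M \<and> (V, \<psi>) \<in> atlas N}\<rparr>"

text \<open>
  Smoothness of a map defined on a subset \<open>A\<close> of a manifold: it extends smoothly near each point
  of \<open>A\<close>. If \<open>A\<close> is an embedded submanifold, then this is smoothness with respect to the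
  submanifold structure of \<open>A\<close>.
\<close>

definition smooth_map_on_subset ::
  "('a, 'e::real_inner) manifold \<Rightarrow> 'a set \<Rightarrow> ('b, 'f::real_inner) manifold \<Rightarrow> ('a \<Rightarrow> 'b) \<Rightarrow> bool"
  where
  "smooth_map_on_subset M A N f \<longleftrightarrow>
     A \<subseteq> carr M \<and>
     (\<forall>p\<in>A. \<exists>W g. openin (mtop M) W \<and> p \<in> W \<and>
        smooth_map (open_submanifold M W) N g \<and> (\<forall>q \<in> A \<inter> W. g q = f q))"


section \<open>Tangent vectors and vector fields\<close>

text \<open>
  Tangent vectors at \<open>p\<close> are derivations at \<open>p\<close> of the algebra of smooth functions. Being total
  functions in HOL, they are normalised to be \<open>0\<close> on non-smooth functions. Smoothness on \<open>M\<close>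
  ignores the values of a function outside \<open>carr M\<close>, and so does a derivation: if \<open>f\<close> vanishes
  on \<open>carr M\<close>, then \<open>f = f \<cdot> \<chi>\<close> for the indicator function \<open>\<chi>\<close> of \<open>- carr M\<close>, which is smooth
  on \<open>M\<close> as well, and the Leibniz rule gives \<open>D f = 0\<close>.
\<close>

type_synonym 'a tangent_vector = "('a \<Rightarrow> real) \<Rightarrow> real"

definition tangent_space ::
  "('a, 'e::real_inner) manifold \<Rightarrow> 'a \<Rightarrow> 'a tangent_vector set" where
  "tangent_space M p =
     {D. (\<forall>f \<in> smooth_functions M. \<forall>g \<in> smooth_functions M.
            D (\<lambda>x. f x + g x) = D f + D g \<and>
            D (\<lambda>x. f x * g x) = f p * D g + g p * D f) \<and>
         (\<forall>c. \<forall>f \<in> smooth_functions M. D (\<lambda>x. c * f x) = c * D f) \<and>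
         (\<forall>f. f \<notin> smooth_functions M \<longrightarrow> D f = 0)}"

text \<open>
  The differential of \<open>f\<close> (a map into \<open>N\<close>) at any point; it does not depend on the source manifold
  and the base point, which are determined by the tangent vector \<open>v\<close> to which it is applied
  (unless \<open>v = 0\<close>).
\<close>

definition pushforward ::
  "('b, 'f::real_inner) manifold \<Rightarrow> ('a \<Rightarrow> 'b) \<Rightarrow> 'a tangent_vector \<Rightarrow> 'b tangent_vector" where
  "pushforward N f v = (\<lambda>g. if g \<in> smooth_functions N then v (g \<circ> f) else 0)"

definition submersion ::
  "('a, 'e::real_inner) manifold \<Rightarrow> ('b, 'f::real_inner) manifold \<Rightarrow> ('a \<Rightarrow> 'b) \<Rightarrow> bool" where
  "submersion M N f \<longleftrightarrow>
     smooth_map M N f \<and>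
     (\<forall>p \<in> carr M. pushforward N f ` tangent_space M p = tangent_space N (f p))"

definition vector_field_on ::
  "('a, 'e::real_inner) manifold \<Rightarrow> 'a set \<Rightarrow> ('a \<Rightarrow> 'a tangent_vector) \<Rightarrow> bool" where
  "vector_field_on M U V \<longleftrightarrow>
     (\<forall>p\<in>U. V p \<in> tangent_space M p) \<and>
     (\<forall>f \<in> smooth_functions M. (\<lambda>p. V p f) \<in> smooth_functions (open_submanifold M U))"

abbreviation vector_field ::
  "('a, 'e::real_inner) manifold \<Rightarrow> ('a \<Rightarrow> 'a tangent_vector) \<Rightarrow> bool" where
  "vector_field M V \<equiv> vector_field_on M (carr M) V"

definition lie_bracket ::
  "('a \<Rightarrow> 'a tangent_vector) \<Rightarrow> ('a \<Rightarrow> 'a tangent_vector) \<Rightarrow> 'a \<Rightarrow> 'a tangent_vector" where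
  "lie_bracket V W p = (\<lambda>f. V p (\<lambda>q. W q f) - W p (\<lambda>q. V q f))"

definition subbundle ::
  "('a, 'e::real_inner) manifold \<Rightarrow> ('a \<Rightarrow> 'a tangent_vector set) \<Rightarrow> bool" where
  "subbundle M E \<longleftrightarrow>
     (\<forall>p \<in> carr M. \<exists>U r V. openin (mtop M) U \<and> p \<in> U \<and>
        (\<forall>i<(r::nat). vector_field_on M U (V i)) \<and>
        (\<forall>q\<in>U. inj_on (\<lambda>i. V i q) {..<r} \<and> independent ((\<lambda>i. V i q) ` {..<r}) \<and>
                E q = span ((\<lambda>i. V i q) ` {..<r})))"


section \<open>Differential forms\<close>

text \<open>
  A \<open>k\<close>-form takes lists of \<open>k\<close> tangent vectors at a common point; its values on all other lists
  are irrelevant, whence the relation \<open>forms_eq\<close>.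
\<close>

type_synonym 'a form = "'a \<Rightarrow> 'a tangent_vector list \<Rightarrow> real"

definition tangent_tuples ::
  "('a, 'e::real_inner) manifold \<Rightarrow> nat \<Rightarrow> 'a \<Rightarrow> 'a tangent_vector list set" where
  "tangent_tuples M k p = {vs. length vs = k \<and> set vs \<subseteq> tangent_space M p}"

definition forms_eq ::
  "('a, 'e::real_inner) manifold \<Rightarrow> nat \<Rightarrow> 'a form \<Rightarrow> 'a form \<Rightarrow> bool" where
  "forms_eq M k \<eta> \<eta>' \<longleftrightarrow> (\<forall>p \<in> carr M. \<forall>vs \<in> tangent_tuples M k p. \<eta> p vs = \<eta>' p vs)"

definition diff_form :: "('a, 'e::real_inner) manifold \<Rightarrow> nat \<Rightarrow> 'a form \<Rightarrow> bool" where
  "diff_form M k \<omega> \<longleftrightarrow>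
     (\<forall>p \<in> carr M. \<forall>vs \<in> tangent_tuples M k p.
        (\<forall>i<k. \<forall>v \<in> tangent_space M p. \<forall>w \<in> tangent_space M p. \<forall>c.
           \<omega> p (vs[i := v + w]) = \<omega> p (vs[i := v]) + \<omega> p (vs[i := w]) \<and>
           \<omega> p (vs[i := c *\<^sub>R v]) = c * \<omega> p (vs[i := v])) \<and>
        (\<forall>i<k. \<forall>j<k. i \<noteq> j \<and> vs ! i = vs ! j \<longrightarrow> \<omega> p vs = 0)) \<and>
     (\<forall>Vs. length Vs = k \<and> (\<forall>V \<in> set Vs. vector_field M V) \<longrightarrow>
        (\<lambda>p. \<omega> p (map (\<lambda>V. V p) Vs)) \<in> smooth_functions M)"

definition pullback :: "('b, 'f::real_inner) manifold \<Rightarrow> ('a \<Rightarrow> 'b) \<Rightarrow> 'b form \<Rightarrow> 'a form" where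
  "pullback N f \<omega> = (\<lambda>p vs. \<omega> (f p) (map (pushforward N f) vs))"


section \<open>Lie groupoids\<close>

text \<open>
  \<open>comp_arr G g h\<close> is \<open>g \<circ> h\<close>, defined when \<open>src G g = tgt G h\<close>. As source and target are
  submersions, the composable pairs form an embedded submanifold of the product manifold.
\<close>

record ('o, 'd, 'a, 'e) lie_groupoid =
  objs :: "('o, 'd) manifold"
  arrs :: "('a, 'e) manifold"
  src :: "'a \<Rightarrow> 'o"
  tgt :: "'a \<Rightarrow> 'o"
  comp_arr :: "'a \<Rightarrow> 'a \<Rightarrow> 'a"
  unit_arr :: "'o \<Rightarrow> 'a"
  inv_arr :: "'a \<Rightarrow> 'a"

definition composable :: "('o, 'd, 'a, 'e) lie_groupoid \<Rightarrow> ('a \<times> 'a) set" where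
  "composable G = {(g, h). g \<in> carr (arrs G) \<and> h \<in> carr (arrs G) \<and> src G g = tgt G h}"

definition is_lie_groupoid ::
  "('o, 'd::real_inner, 'a, 'e::real_inner) lie_groupoid \<Rightarrow> bool" where
  "is_lie_groupoid G \<longleftrightarrow>
     smooth_manifold (objs G) \<and>
     smooth_manifold (arrs G) \<and>
     submersion (arrs G) (objs G) (src G) \<and>
     submersion (arrs G) (objs G) (tgt G) \<and>
     smooth_map (objs G) (arrs G) (unit_arr G) \<and>
     smooth_map (arrs G) (arrs G) (inv_arr G) \<and>
     smooth_map_on_subset (prod_manifold (arrs G) (arrs G)) (composable G) (arrs G)
       (\<lambda>(g, h). comp_arr G g h) \<and>
     (\<forall>(g, h) \<in> composable G.
        comp_arr G g h \<in> carr (arrs G) \<and>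
        src G (comp_arr G g h) = src G h \<and>
        tgt G (comp_arr G g h) = tgt G g) \<and>
     (\<forall>g h l. (g, h) \<in> composable G \<and> (h, l) \<in> composable G \<longrightarrow>
        comp_arr G (comp_arr G g h) l = comp_arr G g (comp_arr G h l)) \<and>
     (\<forall>a \<in> carr (objs G). src G (unit_arr G a) = a \<and> tgt G (unit_arr G a) = a) \<and>
     (\<forall>g \<in> carr (arrs G).
        comp_arr G g (unit_arr G (src G g)) = g \<and>
        comp_arr G (unit_arr G (tgt G g)) g = g \<and>
        src G (inv_arr G g) = tgt G g \<and>
        tgt G (inv_arr G g) = src G g \<and>
        comp_arr G g (inv_arr G g) = unit_arr G (tgt G g) \<and>
        comp_arr G (inv_arr G g) g = unit_arr G (src G g))"

definition lie_groupoid_morphism ::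
  "('o, 'd::real_inner, 'a, 'e::real_inner) lie_groupoid \<Rightarrow>
   ('p, 'd2::real_inner, 'b, 'e2::real_inner) lie_groupoid \<Rightarrow>
   ('a \<Rightarrow> 'b) \<Rightarrow> ('o \<Rightarrow> 'p) \<Rightarrow> bool" where
  "lie_groupoid_morphism X Y F1 F0 \<longleftrightarrow>
     smooth_map (arrs X) (arrs Y) F1 \<and>
     smooth_map (objs X) (objs Y) F0 \<and>
     (\<forall>g \<in> carr (arrs X). src Y (F1 g) = F0 (src X g) \<and> tgt Y (F1 g) = F0 (tgt X g)) \<and>
     (\<forall>a \<in> carr (objs X). F1 (unit_arr X a) = unit_arr Y (F0 a)) \<and>
     (\<forall>(g, h) \<in> composable X. F1 (comp_arr X g h) = comp_arr Y (F1 g) (F1 h))"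


section \<open>Connections on Lie groupoids\<close>

abbreviation src_push ::
  "('o, 'd::real_inner, 'a, 'e::real_inner) lie_groupoid \<Rightarrow>
   'a tangent_vector \<Rightarrow> 'o tangent_vector" where
  "src_push G \<equiv> pushforward (objs G) (src G)"

abbreviation tgt_push ::
  "('o, 'd::real_inner, 'a, 'e::real_inner) lie_groupoid \<Rightarrow>
   'a tangent_vector \<Rightarrow> 'o tangent_vector" where
  "tgt_push G \<equiv> pushforward (objs G) (tgt G)"

definition ker_src ::
  "('o, 'd::real_inner, 'a, 'e::real_inner) lie_groupoid \<Rightarrow> 'a \<Rightarrow> 'a tangent_vector set" where
  "ker_src G g = {v \<in> tangent_space (arrs G) g. src_push G v = 0}"

definition transport ::
  "('o, 'd::real_inner, 'a, 'e::real_inner) lie_groupoid \<Rightarrow> ('a \<Rightarrow> 'a tangent_vector set) \<Rightarrow>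
   'a \<Rightarrow> 'o tangent_vector \<Rightarrow> 'o tangent_vector" where
  "transport G H g = tgt_push G \<circ> inv_into (H g) (src_push G)"

definition connection ::
  "('o, 'd::real_inner, 'a, 'e::real_inner) lie_groupoid \<Rightarrow>
   ('a \<Rightarrow> 'a tangent_vector set) \<Rightarrow> bool" where
  "connection G H \<longleftrightarrow>
     subbundle (arrs G) H \<and>
     (\<forall>g \<in> carr (arrs G).
        H g \<inter> ker_src G g = {0} \<and>
        {h + k | h k. h \<in> H g \<and> k \<in> ker_src G g} = tangent_space (arrs G) g) \<and>
     (\<forall>(g, h) \<in> composable G. \<forall>w \<in> tangent_space (objs G) (src G h).
        transport G H (comp_arr G g h) w = transport G H g (transport G H h w)) \<and>
     (\<forall>a \<in> carr (objs G).
        pushforward (arrs G) (unit_arr G) ` tangent_space (objs G) a = H (unit_arr G a))"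

definition integrable_connection ::
  "('o, 'd::real_inner, 'a, 'e::real_inner) lie_groupoid \<Rightarrow>
   ('a \<Rightarrow> 'a tangent_vector set) \<Rightarrow> bool" where
  "integrable_connection G H \<longleftrightarrow>
     connection G H \<and>
     (\<forall>V W. vector_field (arrs G) V \<and> vector_field (arrs G) W \<and>
        (\<forall>g \<in> carr (arrs G). V g \<in> H g \<and> W g \<in> H g) \<longrightarrow>
        (\<forall>g \<in> carr (arrs G). lie_bracket V W g \<in> H g))"

definition horizontal ::
  "('o, 'd::real_inner, 'a, 'e::real_inner) lie_groupoid \<Rightarrow> ('a \<Rightarrow> 'a tangent_vector set) \<Rightarrow>
   'a \<Rightarrow> 'a tangent_vector \<Rightarrow> 'a tangent_vector" where
  "horizontal G H g v = (THE h. h \<in> H g \<and> v - h \<in> ker_src G g)"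

definition horizontal_form ::
  "('o, 'd::real_inner, 'a, 'e::real_inner) lie_groupoid \<Rightarrow> ('a \<Rightarrow> 'a tangent_vector set) \<Rightarrow>
   'a form \<Rightarrow> 'a form" where
  "horizontal_form G H \<eta> = (\<lambda>g vs. \<eta> g (map (horizontal G H g) vs))"

definition groupoid_form ::
  "('o, 'd::real_inner, 'a, 'e::real_inner) lie_groupoid \<Rightarrow> ('a \<Rightarrow> 'a tangent_vector set) \<Rightarrow>
   nat \<Rightarrow> 'o form \<Rightarrow> bool" where
  "groupoid_form G H k \<omega> \<longleftrightarrow>
     diff_form (objs G) k \<omega> \<and>
     forms_eq (arrs G) k
       (horizontal_form G H (pullback (objs G) (src G) \<omega>))
       (horizontal_form G H (pullback (objs G) (tgt G) \<omega>))"

definition compatible_with_connections ::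
  "('o, 'd::real_inner, 'a, 'e::real_inner) lie_groupoid \<Rightarrow> ('a \<Rightarrow> 'a tangent_vector set) \<Rightarrow>
   ('p, 'd2::real_inner, 'b, 'e2::real_inner) lie_groupoid \<Rightarrow> ('b \<Rightarrow> 'b tangent_vector set) \<Rightarrow>
   ('a \<Rightarrow> 'b) \<Rightarrow> bool" where
  "compatible_with_connections X HX Y HY F1 \<longleftrightarrow>
     (\<forall>g \<in> carr (arrs X). \<forall>v \<in> tangent_space (arrs X) g.
        pushforward (arrs Y) F1 (horizontal X HX g v) =
        horizontal Y HY (F1 g) (pushforward (arrs Y) F1 v))"

end

theory Submission
  imports Defs
begin

text \<open>
  The condition on a groupoid form is pointwise. A tuple of tangent vectors at an arrow of
  \<open>Y\<close> lifts along the surjective submersion \<open>F1\<close>; compatibility moves the horizontal projection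
  to \<open>X\<close>, and functoriality of the differential applied to \<open>src \<circ> F1 = F0 \<circ> src\<close> (likewise for
  \<open>tgt\<close>) identifies both sides of the condition on \<open>\<omega>\<close> with those of the condition on
  \<open>F0\<^sup>*\<omega>\<close>. As tangent vectors are derivations, functoriality rests on the chain rule for
  smooth maps and on the insensitivity of derivations to values outside the carrier.
\<close>

section \<open>Functions of class \<open>C\<^sup>k\<close>\<close>

text \<open>On an open set the derivative at a point sees only nearby values, all taken inside
  \<open>S\<close>. Both functions are generalised because the induction passes to their directional
  derivatives.\<close>

lemma Ck_on_cong:
  assumes "open S" "\<And>x. x \<in> S \<Longrightarrow> f x = g x"
  shows "Ck_on k S f \<longleftrightarrow> Ck_on k S g"
  using assms(2)
proof (induction k arbitrary: f g)
  case 0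
  then show ?case by (simp cong: continuous_on_cong)
next
  case (Suc k)
  have deriv: "(f has_derivative D) (at x) \<longleftrightarrow> (g has_derivative D) (at x)" if "x \<in> S" for x D
    using has_derivative_transform_within_open[OF _ assms(1) that] Suc.prems by metis
  have "f differentiable at x \<longleftrightarrow> g differentiable at x" if "x \<in> S" for x
    using deriv[OF that] by (simp add: differentiable_def)
  moreover have "frechet_derivative f (at x) v = frechet_derivative g (at x) v" if "x \<in> S" for x v
    using deriv[OF that] by (simp add: frechet_derivative_def)
  ultimately show ?case
    using Suc.IH[of "\<lambda>x. frechet_derivative f (at x) _" "\<lambda>x. frechet_derivative g (at x) _"]
    by (simp cong: ball_cong)
qed

lemma Ck_on_Union:
  assumes "\<And>S. S \<in> \<S> \<Longrightarrow> open S" "\<And>S. S \<in> \<S> \<Longrightarrow> Ck_on k S f"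
  shows "Ck_on k (\<Union>\<S>) f"
  using assms(2)
proof (induction k arbitrary: f)
  case 0
  then show ?case using assms(1) by (auto intro!: continuous_on_open_Union)
next
  case (Suc k)
  then show ?case by auto
qed

text \<open>Needed for the product and chain rules, where undifferentiated factors reappear inside a
  derivative one order lower.\<close>

lemma Ck_on_Suc_imp: "Ck_on (Suc k) S f \<Longrightarrow> Ck_on k S f"
proof (induction k arbitrary: f)
  case 0
  then show ?case
    by (simp add: continuous_at_imp_continuous_on differentiable_imp_continuous_within)
next
  case (Suc k)
  then show ?case by (metis Ck_on.simps(2))
qed

section \<open>Closure properties of the classes C^k\<close>

lemma Ck_on_const: "Ck_on k S (\<lambda>x. c)"
  by (induction k arbitrary: c) (auto simp: frechet_derivative_const)

text \<open>The formula for the derivative holds only at points of \<open>S\<close>, so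
  \<open>Ck_on_cong\<close> substitutes it under \<open>Ck_on\<close>. The next closure lemmas
  follow the same pattern.\<close>

lemma Ck_on_add:
  assumes "open S" "Ck_on k S f" "Ck_on k S g"
  shows "Ck_on k S (\<lambda>x. f x + g x)"
  using assms(2,3)
proof (induction k arbitrary: f g)
  case 0
  then show ?case by (simp add: continuous_on_add)
next
  case (Suc k)
  have deriv: "((\<lambda>x. f x + g x) has_derivative
      (\<lambda>v. frechet_derivative f (at x) v + frechet_derivative g (at x) v)) (at x)"
    if "x \<in> S" for x
    using Suc.prems that by (intro has_derivative_add) (auto simp: frechet_derivative_works)
  have "Ck_on k S (\<lambda>x. frechet_derivative (\<lambda>x. f x + g x) (at x) v)" for v
  proof (subst Ck_on_cong[OF assms(1)])
    show "frechet_derivative (\<lambda>x. f x + g x) (at x) v =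
        frechet_derivative f (at x) v + frechet_derivative g (at x) v" if "x \<in> S" for x
      using frechet_derivative_at[OF deriv[OF that]] by metis
    show "Ck_on k S (\<lambda>x. frechet_derivative f (at x) v + frechet_derivative g (at x) v)"
      using Suc by simp
  qed
  then show ?case using deriv by (auto simp: differentiable_def)
qed

lemma Ck_on_sum:
  assumes "open S" "\<And>i. i \<in> I \<Longrightarrow> Ck_on k S (f i)"
  shows "Ck_on k S (\<lambda>x. \<Sum>i\<in>I. f i x)"
  using assms(2)
  \<comment> \<open>Over an infinite index set the sum is 0 by convention, hence constant.\<close>
  by (induction I rule: infinite_finite_induct) (auto intro: Ck_on_const Ck_on_add[OF assms(1)])

lemma Ck_on_scaleR:
  assumes "open S" "Ck_on k S a" "Ck_on k S f"
  shows "Ck_on k S (\<lambda>x. a x *\<^sub>R f x)"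
  using assms(2,3)
proof (induction k arbitrary: a f)
  case 0
  then show ?case by (simp add: continuous_on_scaleR)
next
  case (Suc k)
  have deriv: "((\<lambda>x. a x *\<^sub>R f x) has_derivative
      (\<lambda>v. a x *\<^sub>R frechet_derivative f (at x) v + frechet_derivative a (at x) v *\<^sub>R f x)) (at x)"
    if "x \<in> S" for x
    using Suc.prems that by (intro has_derivative_scaleR) (auto simp: frechet_derivative_works)
  have "Ck_on k S (\<lambda>x. frechet_derivative (\<lambda>x. a x *\<^sub>R f x) (at x) v)" for v
  proof (subst Ck_on_cong[OF assms(1)])
    show "frechet_derivative (\<lambda>x. a x *\<^sub>R f x) (at x) v =
        a x *\<^sub>R frechet_derivative f (at x) v + frechet_derivative a (at x) v *\<^sub>R f x"
      if "x \<in> S" for x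
      using frechet_derivative_at[OF deriv[OF that]] by metis
    show "Ck_on k S (\<lambda>x. a x *\<^sub>R frechet_derivative f (at x) v +
        frechet_derivative a (at x) v *\<^sub>R f x)"
      using Suc.prems Suc.prems[THEN Ck_on_Suc_imp] by (intro Ck_on_add assms(1) Suc.IH) auto
  qed
  then show ?case using deriv by (auto simp: differentiable_def)
qed

lemma Ck_on_bounded_linear:
  assumes "bounded_linear L" "open S" "Ck_on k S f"
  shows "Ck_on k S (\<lambda>x. L (f x))"
  using assms(3)
proof (induction k arbitrary: f)
  case 0
  then show ?case using assms(1) by (simp add: bounded_linear.continuous_on)
next
  case (Suc k)
  have deriv: "((\<lambda>x. L (f x)) has_derivative (\<lambda>v. L (frechet_derivative f (at x) v))) (at x)"
    if "x \<in> S" for x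
    using Suc.prems that
    by (intro bounded_linear.has_derivative[OF assms(1)]) (auto simp: frechet_derivative_works)
  have "Ck_on k S (\<lambda>x. frechet_derivative (\<lambda>x. L (f x)) (at x) v)" for v
  proof (subst Ck_on_cong[OF assms(2)])
    show "frechet_derivative (\<lambda>x. L (f x)) (at x) v = L (frechet_derivative f (at x) v)"
      if "x \<in> S" for x
      using frechet_derivative_at[OF deriv[OF that]] by metis
    show "Ck_on k S (\<lambda>x. L (frechet_derivative f (at x) v))"
      using Suc by simp
  qed
  then show ?case using deriv by (auto simp: differentiable_def)
qed

section \<open>Orthogonal expansion and the chain rule\<close>

text \<open>Division by \<open>0\<close> makes the summand of a possible zero vector in \<open>C\<close> vanish.\<close>

lemma orthogonal_expansion:
  fixes C :: "'a::real_inner set"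
  assumes "finite C" "pairwise orthogonal C" "v \<in> span C"
  shows "v = (\<Sum>c\<in>C. ((v \<bullet> c) / (c \<bullet> c)) *\<^sub>R c)"
proof -
  \<comment> \<open>The residual \<open>w\<close> is orthogonal to \<open>C\<close> and lies in its
    span, so it is orthogonal to itself.\<close>
  define w where "w = v - (\<Sum>c\<in>C. ((v \<bullet> c) / (c \<bullet> c)) *\<^sub>R c)"
  have "orthogonal w c" if "c \<in> C" for c
  proof -
    have "(\<Sum>d\<in>C. ((v \<bullet> d) / (d \<bullet> d)) *\<^sub>R d) \<bullet> c = (\<Sum>d\<in>C. if d = c then v \<bullet> c else 0)"
      unfolding inner_sum_left
    proof (rule sum.cong)
      fix d assume "d \<in> C"
      then have "d \<noteq> c \<Longrightarrow> d \<bullet> c = 0"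
        using assms(2) that by (auto simp: pairwise_def orthogonal_def)
      then show "((v \<bullet> d) / (d \<bullet> d)) *\<^sub>R d \<bullet> c = (if d = c then v \<bullet> c else 0)"
        by auto
    qed simp
    then show ?thesis
      using assms(1) that by (simp add: w_def orthogonal_def inner_diff_left)
  qed
  moreover have "w \<in> span C"
    unfolding w_def using assms(3) by (intro span_diff span_sum span_scale) (auto intro: span_base)
  ultimately have "orthogonal w w"
    using orthogonal_to_span by blast
  then have "w = 0"
    by (simp add: orthogonal_def)
  then show ?thesis
    by (simp add: w_def)
qed

text \<open>The derivative of the composite applies \<open>g'\<close> at \<open>f x\<close> in the
  direction \<open>f' x v\<close>, which varies with \<open>x\<close>, whereas \<open>Ck_on\<close>
  controls fixed directions only. Expanding this direction in a finite orthogonal spanning set gives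
  a finite sum of products with fixed directions; finite dimension enters here.\<close>

lemma Ck_on_compose:
  fixes f :: "'e::real_normed_vector \<Rightarrow> 'f::real_inner" and g :: "'f \<Rightarrow> 'g::real_normed_vector"
  assumes "finite B" "span B = (UNIV :: 'f set)"
    and "open S" "f ` S \<subseteq> T" "Ck_on k S f" "Ck_on k T g"
  shows "Ck_on k S (\<lambda>x. g (f x))"
proof -
  obtain C :: "'f set" where C: "finite C" "pairwise orthogonal C" "span C = UNIV"
    using basis_orthogonal[OF assms(1)] assms(2) by metis
  show ?thesis
    using assms(5,6)
  proof (induction k arbitrary: g)
    case 0
    then show ?case using assms(4) by (auto intro: continuous_on_compose2)
  next
    case (Suc k)
    let ?f' = "\<lambda>x. frechet_derivative f (at x)" and ?g' = "\<lambda>y. frechet_derivative g (at y)"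
    have deriv: "((\<lambda>x. g (f x)) has_derivative (\<lambda>v. ?g' (f x) (?f' x v))) (at x)"
      if "x \<in> S" for x
    proof -
      have "(f has_derivative ?f' x) (at x)"
        using Suc.prems that by (simp add: frechet_derivative_works[symmetric])
      moreover have "(g has_derivative ?g' (f x)) (at (f x))"
        using Suc.prems that assms(4) by (auto simp: frechet_derivative_works[symmetric])
      ultimately show ?thesis
        by (rule has_derivative_compose)
    qed
    have "Ck_on k S (\<lambda>x. frechet_derivative (\<lambda>x. g (f x)) (at x) v)" for v
    proof (subst Ck_on_cong[OF assms(3)])
      show "frechet_derivative (\<lambda>x. g (f x)) (at x) v =
          (\<Sum>c\<in>C. ((?f' x v \<bullet> c) / (c \<bullet> c)) *\<^sub>R ?g' (f x) c)" if "x \<in> S" for x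
      proof -
        have "linear (?g' (f x))"
          using Suc.prems that assms(4) by (intro linear_frechet_derivative) auto
        then have "?g' (f x) (\<Sum>c\<in>C. ((?f' x v \<bullet> c) / (c \<bullet> c)) *\<^sub>R c) =
            (\<Sum>c\<in>C. ((?f' x v \<bullet> c) / (c \<bullet> c)) *\<^sub>R ?g' (f x) c)"
          by (simp add: linear_sum linear_scale)
        moreover have "?f' x v = (\<Sum>c\<in>C. ((?f' x v \<bullet> c) / (c \<bullet> c)) *\<^sub>R c)"
          using C by (intro orthogonal_expansion) auto
        ultimately have "?g' (f x) (?f' x v) =
            (\<Sum>c\<in>C. ((?f' x v \<bullet> c) / (c \<bullet> c)) *\<^sub>R ?g' (f x) c)"
          by metis
        then show ?thesis
          using frechet_derivative_at[OF deriv[OF that]] by metis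
      qed
      have "Ck_on k S (\<lambda>x. (?f' x v \<bullet> c) / (c \<bullet> c))" for c
      proof (rule Ck_on_bounded_linear[where L = "\<lambda>u. (u \<bullet> c) / (c \<bullet> c)"])
        show "bounded_linear (\<lambda>u. (u \<bullet> c) / (c \<bullet> c))"
          by (rule bounded_linear_compose[OF bounded_linear_divide bounded_linear_inner_left])
      qed (use Suc.prems assms(3) in auto)
      moreover have "Ck_on k S (\<lambda>x. ?g' (f x) c)" for c
        \<comment> \<open>The inner map stays \<open>f\<close>, weakened to order \<open>k\<close>;
          only the outer map is replaced by its derivative.\<close>
        using Suc.prems Ck_on_Suc_imp[OF Suc.prems(1)]
        by (intro Suc.IH[of "\<lambda>y. ?g' y c"]) simp_all
      ultimately show "Ck_on k S (\<lambda>x. \<Sum>c\<in>C. ((?f' x v \<bullet> c) / (c \<bullet> c)) *\<^sub>R ?g' (f x) c)"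
        by (intro Ck_on_sum Ck_on_scaleR assms(3)) auto
    qed
    then show ?case using deriv by (auto simp: differentiable_def)
  qed
qed


section \<open>Smooth functions and differentials\<close>

lemma smooth_functions_iff:
  "f \<in> smooth_functions M \<longleftrightarrow>
     continuous_map (mtop M) euclideanreal f \<and>
     (\<forall>(U, \<phi>) \<in> atlas M. smooth_on (\<phi> ` U) (f \<circ> inv_into U \<phi>))"
  by (simp add: smooth_functions_def smooth_map_def real_line_def)

lemma chart_open:
  assumes "smooth_manifold M" "(U, \<phi>) \<in> atlas M"
  shows "openin (mtop M) U" "open (\<phi> ` U)" "U \<subseteq> carr M"
  using assms openin_subset by (fastforce simp: smooth_manifold_def)+

lemma chart_image_open:
  assumes "smooth_manifold M" "(U, \<phi>) \<in> atlas M" "openin (mtop M) W" "W \<subseteq> U"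
  shows "open (\<phi> ` W)"
proof -
  have "homeomorphic_map (subtopology (mtop M) U) (top_of_set (\<phi> ` U)) \<phi>"
    using assms(1,2) by (auto simp: smooth_manifold_def)
  moreover have "openin (subtopology (mtop M) U) W"
    using assms(3,4) by (auto simp: openin_subtopology)
  ultimately have "openin (top_of_set (\<phi> ` U)) (\<phi> ` W)"
    by (meson homeomorphic_imp_open_map open_map_def)
  then show ?thesis
    using chart_open(2)[OF assms(1,2)] openin_open_trans by blast
qed

lemma chart_inj:
  assumes "smooth_manifold M" "(U, \<phi>) \<in> atlas M"
  shows "inj_on \<phi> U"
proof -
  have "homeomorphic_map (subtopology (mtop M) U) (top_of_set (\<phi> ` U)) \<phi>"
    using assms by (auto simp: smooth_manifold_def)
  then have "inj_on \<phi> (topspace (subtopology (mtop M) U))"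
    by (rule homeomorphic_imp_injective_map)
  then show ?thesis
    using chart_open(3)[OF assms] by (simp add: Int_absorb1)
qed

text \<open>Chart domains lie in the carrier, so neither continuity nor the chart expressions see
  values outside it.\<close>

lemma smooth_functions_cong:
  assumes "smooth_manifold M" "\<And>x. x \<in> carr M \<Longrightarrow> f x = g x"
  shows "f \<in> smooth_functions M \<longleftrightarrow> g \<in> smooth_functions M"
proof -
  have "smooth_on (\<phi> ` U) (f \<circ> inv_into U \<phi>) \<longleftrightarrow> smooth_on (\<phi> ` U) (g \<circ> inv_into U \<phi>)"
    if "(U, \<phi>) \<in> atlas M" for U \<phi>
  proof -
    have "(f \<circ> inv_into U \<phi>) y = (g \<circ> inv_into U \<phi>) y" if "y \<in> \<phi> ` U" for y
      using inv_into_into[OF that] chart_open(3)[OF assms(1) \<open>(U, \<phi>) \<in> atlas M\<close>] assms(2) by auto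
    then show ?thesis
      unfolding smooth_on_def using Ck_on_cong[OF chart_open(2)[OF assms(1) that]] by blast
  qed
  moreover have "continuous_map (mtop M) euclideanreal f \<longleftrightarrow> continuous_map (mtop M) euclideanreal g"
    using assms(2) continuous_map_eq by metis
  ultimately show ?thesis
    by (auto simp: smooth_functions_iff)
qed

lemma const_smooth_functions: "(\<lambda>x. c) \<in> smooth_functions M"
  by (auto simp: smooth_functions_iff smooth_on_def o_def Ck_on_const)

text \<open>A chart domain of \<open>M\<close> need not map into a single chart of \<open>N\<close>.
  It is cut into open pieces that do; on each piece the transition through the chart of
  \<open>N\<close> writes the composite as two C^k maps, and \<open>Ck_on_Union\<close> reassembles
  the pieces.\<close>

lemma smooth_functions_compose:
  fixes N :: "('b, 'f::real_inner) manifold"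
  assumes "smooth_manifold M" "smooth_manifold N" "smooth_map M N f" "g \<in> smooth_functions N"
  shows "g \<circ> f \<in> smooth_functions M"
  unfolding smooth_functions_iff
proof (intro conjI ballI, safe)
  have cont: "continuous_map (mtop M) (mtop N) f"
    using assms(3) by (simp add: smooth_map_def)
  then show "continuous_map (mtop M) euclideanreal (g \<circ> f)"
    using assms(4) by (auto simp: smooth_functions_iff intro: continuous_map_compose)
  fix U \<phi> assume U: "(U, \<phi>) \<in> atlas M"
  obtain B :: "'f set" where B: "finite B" "span B = UNIV"
    using assms(2) by (auto simp: smooth_manifold_def)
  define \<S> where "\<S> = (\<lambda>(V, \<psi> :: 'b \<Rightarrow> 'f). \<phi> ` (U \<inter> f -` V)) ` atlas N"
  have "\<exists>(V, \<psi>) \<in> atlas N. f x \<in> V" if "x \<in> U" for x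
  proof -
    have "f x \<in> carr N"
      using that chart_open(3)[OF assms(1) U] continuous_map_image_subset_topspace[OF cont] by blast
    moreover have "(\<Union>(V, \<psi>) \<in> atlas N. V) = carr N"
      using assms(2) by (simp add: smooth_manifold_def)
    ultimately show ?thesis by blast
  qed
  then have cover: "\<phi> ` U = \<Union>\<S>"
    by (fastforce simp: \<S>_def)
  have opn: "open (\<phi> ` (U \<inter> f -` V))" if V: "(V, \<psi>) \<in> atlas N" for V \<psi>
  proof (rule chart_image_open[OF assms(1) U])
    have "openin (mtop M) (U \<inter> {x \<in> carr M. f x \<in> V})"
      using cont chart_open(1)[OF assms(1) U] chart_open(1)[OF assms(2) V]
      by (intro openin_Int openin_continuous_map_preimage)
    moreover have "U \<inter> {x \<in> carr M. f x \<in> V} = U \<inter> f -` V"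
      using chart_open(3)[OF assms(1) U] by blast
    ultimately show "openin (mtop M) (U \<inter> f -` V)" by simp
  qed simp
  have "Ck_on k (\<phi> ` (U \<inter> f -` V)) (g \<circ> f \<circ> inv_into U \<phi>)"
    if V: "(V, \<psi>) \<in> atlas N" for k V \<psi>
  proof -
    have inv: "inv_into U \<phi> y \<in> U \<and> f (inv_into U \<phi> y) \<in> V" if "y \<in> \<phi> ` (U \<inter> f -` V)" for y
      using that chart_inj[OF assms(1) U] by auto
    have "Ck_on k (\<phi> ` (U \<inter> f -` V)) (\<lambda>y. (g \<circ> inv_into V \<psi>) ((\<psi> \<circ> f \<circ> inv_into U \<phi>) y))"
    proof (rule Ck_on_compose[OF B opn[OF V]])
      show "(\<psi> \<circ> f \<circ> inv_into U \<phi>) ` \<phi> ` (U \<inter> f -` V) \<subseteq> \<psi> ` V"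
        using inv by auto
      show "Ck_on k (\<phi> ` (U \<inter> f -` V)) (\<psi> \<circ> f \<circ> inv_into U \<phi>)"
        using assms(3) U V unfolding smooth_map_def smooth_on_def by blast
      show "Ck_on k (\<psi> ` V) (g \<circ> inv_into V \<psi>)"
        using assms(4) V by (auto simp: smooth_functions_iff smooth_on_def)
    qed
    then show ?thesis
      using inv chart_inj[OF assms(2) V] by (subst Ck_on_cong[OF opn[OF V]]) auto
  qed
  then show "smooth_on (\<phi> ` U) (g \<circ> f \<circ> inv_into U \<phi>)"
    unfolding smooth_on_def cover using opn by (auto simp: \<S>_def intro!: Ck_on_Union)
qed

text \<open>The difference \<open>d\<close> vanishes on the carrier, so it equals
  \<open>d * e\<close> for the indicator \<open>e\<close> of the complement. Both factors vanish at
  \<open>p\<close>, and the Leibniz rule gives \<open>D d = 0\<close>.\<close>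

lemma tangent_vector_cong:
  assumes "smooth_manifold M" "p \<in> carr M" "D \<in> tangent_space M p"
    and eq: "\<And>x. x \<in> carr M \<Longrightarrow> f x = g x"
  shows "D f = D g"
proof (cases "g \<in> smooth_functions M")
  \<comment> \<open>Neither function is smooth, so both values are the default 0.\<close>
  case False
  then have "f \<notin> smooth_functions M"
    using smooth_functions_cong[OF assms(1)] eq by blast
  with False assms(3) show ?thesis
    by (simp add: tangent_space_def)
next
  case True
  define d where "d = (\<lambda>x. f x - g x)"
  define e where "e = (\<lambda>x. if x \<in> carr M then 0 else 1 :: real)"
  have smooth: "d \<in> smooth_functions M" "e \<in> smooth_functions M"
    using smooth_functions_cong[OF assms(1), of d "\<lambda>x. 0"]
      smooth_functions_cong[OF assms(1), of e "\<lambda>x. 0"] const_smooth_functions eq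
    by (auto simp: d_def e_def)
  have "D (\<lambda>x. d x * e x) = d p * D e + e p * D d"
    using assms(3) smooth by (simp add: tangent_space_def)
  moreover have "(\<lambda>x. d x * e x) = d"
    using eq by (auto simp: d_def e_def)
  ultimately have "D d = 0"
    using assms(2) eq by (simp add: d_def e_def)
  moreover have "D (\<lambda>x. g x + d x) = D g + D d"
    using assms(3) True smooth by (simp add: tangent_space_def)
  moreover have "(\<lambda>x. g x + d x) = f"
    by (simp add: d_def)
  ultimately show ?thesis by simp
qed

lemma tangent_space_diff:
  assumes "v \<in> tangent_space M p" "w \<in> tangent_space M p"
  shows "v - w \<in> tangent_space M p"
  using assms by (auto simp: tangent_space_def algebra_simps)

lemma pushforward_diff: "pushforward N f (v - w) = pushforward N f v - pushforward N f w"
  by (simp add: pushforward_def fun_eq_iff)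

text \<open>Both sides evaluate \<open>v\<close> on composites that agree on \<open>carr M\<close>
  only, which suffices by \<open>tangent_vector_cong\<close>. Smoothness of
  \<open>h \<circ> g\<close> and \<open>h \<circ> g'\<close> ensures that the inner differentials do
  not return their default 0.\<close>

lemma pushforward_square:
  assumes "smooth_manifold M" "smooth_manifold N" "smooth_manifold N'" "smooth_manifold P"
    and "smooth_map M N f" "smooth_map N P g" "smooth_map M N' f'" "smooth_map N' P g'"
    and "\<And>x. x \<in> carr M \<Longrightarrow> g (f x) = g' (f' x)"
    and "p \<in> carr M" "v \<in> tangent_space M p"
  shows "pushforward P g (pushforward N f v) = pushforward P g' (pushforward N' f' v)"
proof
  fix h
  have "v (h \<circ> g \<circ> f) = v (h \<circ> g' \<circ> f')"
    using assms(9) by (intro tangent_vector_cong[OF assms(1,10,11)]) simp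
  then show "pushforward P g (pushforward N f v) h = pushforward P g' (pushforward N' f' v) h"
    using smooth_functions_compose[OF assms(2,4,6)] smooth_functions_compose[OF assms(3,4,8)]
    by (simp add: pushforward_def)
qed


section \<open>Horizontal components\<close>

lemma ker_src_diff:
  assumes "v \<in> ker_src G g" "w \<in> ker_src G g"
  shows "v - w \<in> ker_src G g"
  using assms by (simp add: ker_src_def pushforward_diff tangent_space_diff)

lemma connection_subspace:
  fixes G :: "('o, 'd::real_inner, 'a, 'e::real_inner) lie_groupoid"
  assumes "connection G H" "g \<in> carr (arrs G)"
  shows "subspace (H g)"
proof -
  have "subbundle (arrs G) H"
    using assms(1) by (simp add: connection_def)
  then obtain r and V :: "nat \<Rightarrow> 'a \<Rightarrow> 'a tangent_vector"
    where "H g = span ((\<lambda>i. V i g) ` {..<r})"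
    using assms(2) unfolding subbundle_def by blast
  then show ?thesis
    by simp
qed

text \<open>The direct sum decomposition makes the definite description in \<open>horizontal\<close>
  denote the component \<open>h\<close>; it is tangent because \<open>h = v - k\<close> with
  \<open>v\<close> and \<open>k\<close> tangent.\<close>

lemma horizontal_in_tangent_space:
  assumes "connection G H" "g \<in> carr (arrs G)" "v \<in> tangent_space (arrs G) g"
  shows "horizontal G H g v \<in> tangent_space (arrs G) g"
proof -
  have "\<forall>g \<in> carr (arrs G). H g \<inter> ker_src G g = {0} \<and>
      {h + k | h k. h \<in> H g \<and> k \<in> ker_src G g} = tangent_space (arrs G) g"
    using assms(1) unfolding connection_def by (elim conjE)
  note complement = bspec[OF this assms(2)]
  have inter: "H g \<inter> ker_src G g = {0}"
    and sum: "{h + k | h k. h \<in> H g \<and> k \<in> ker_src G g} = tangent_space (arrs G) g"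
    using complement by (rule conjunct1, rule conjunct2)
  obtain h k where hk: "h \<in> H g" "k \<in> ker_src G g" "v = h + k"
    using assms(3) sum by blast
  have "horizontal G H g v = h"
    unfolding horizontal_def
  proof (rule the_equality)
    show "h \<in> H g \<and> v - h \<in> ker_src G g"
      using hk by simp
  next
    fix h' assume h': "h' \<in> H g \<and> v - h' \<in> ker_src G g"
    \<comment> \<open>Two candidates differ by a vector that is both horizontal and in the kernel,
      hence by 0.\<close>
    have "h' - h \<in> H g"
      using connection_subspace[OF assms(1,2)] hk h' by (simp add: subspace_diff)
    moreover have "k - (v - h') \<in> ker_src G g"
      using hk(2) conjunct2[OF h'] by (rule ker_src_diff)
    moreover have "k - (v - h') = h' - h"
      using hk by simp
    ultimately have "h' - h \<in> H g \<inter> ker_src G g"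
      by (metis IntI)
    then show "h' = h"
      unfolding inter by simp
  qed
  moreover have "v - k \<in> tangent_space (arrs G) g"
    using hk(2) assms(3) by (simp add: ker_src_def tangent_space_diff)
  moreover have "v - k = h"
    using hk(3) by simp
  ultimately show ?thesis
    by metis
qed

section \<open>Descent of the form condition along \<open>F1\<close>\<close>

theorem proposition4p3p6:
  fixes X :: "('o, 'd::real_inner, 'a, 'e::real_inner) lie_groupoid"
    and Y :: "('p, 'd2::real_inner, 'b, 'e2::real_inner) lie_groupoid"
    and HX :: "'a \<Rightarrow> 'a tangent_vector set"
    and HY :: "'b \<Rightarrow> 'b tangent_vector set"
    and F1 :: "'a \<Rightarrow> 'b"
    and F0 :: "'o \<Rightarrow> 'p"
    and k :: nat
    and \<omega> :: "'p form"
  assumes "is_lie_groupoid X"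
    and "is_lie_groupoid Y"
    and "integrable_connection X HX"
    and "integrable_connection Y HY"
    and "lie_groupoid_morphism X Y F1 F0"
    and "compatible_with_connections X HX Y HY F1"
    and "diff_form (objs Y) k \<omega>"
    and "submersion (arrs X) (arrs Y) F1"
    and "F1 ` carr (arrs X) = carr (arrs Y)"
    and "groupoid_form X HX k (pullback (objs Y) F0 \<omega>)"
  shows "groupoid_form Y HY k \<omega>"
proof -
  have manifolds: "smooth_manifold (objs X)" "smooth_manifold (arrs X)"
      "smooth_manifold (objs Y)" "smooth_manifold (arrs Y)"
    and maps: "smooth_map (arrs X) (objs X) (src X)" "smooth_map (arrs X) (objs X) (tgt X)"
      "smooth_map (arrs Y) (objs Y) (src Y)" "smooth_map (arrs Y) (objs Y) (tgt Y)"
    using assms(1,2) by (auto simp: is_lie_groupoid_def submersion_def)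
  have F: "smooth_map (arrs X) (arrs Y) F1" "smooth_map (objs X) (objs Y) F0"
    and src: "\<And>g. g \<in> carr (arrs X) \<Longrightarrow> src Y (F1 g) = F0 (src X g)"
    and tgt: "\<And>g. g \<in> carr (arrs X) \<Longrightarrow> tgt Y (F1 g) = F0 (tgt X g)"
    using assms(5) by (auto simp: lie_groupoid_morphism_def)
  have conn: "connection X HX"
    using assms(3) by (simp add: integrable_connection_def)
  have "horizontal_form Y HY (pullback (objs Y) (src Y) \<omega>) q ws =
      horizontal_form Y HY (pullback (objs Y) (tgt Y) \<omega>) q ws"
    if q: "q \<in> carr (arrs Y)" and ws: "ws \<in> tangent_tuples (arrs Y) k q" for q ws
  proof -
    obtain p where p: "p \<in> carr (arrs X)" "F1 p = q"
      using q unfolding assms(9)[symmetric] by blast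
    have "pushforward (arrs Y) F1 ` tangent_space (arrs X) p = tangent_space (arrs Y) q"
      using assms(8) p by (auto simp: submersion_def)
    \<comment> \<open>Surjectivity of the differential at the chosen preimage \<open>p\<close> lifts
      the tuple entry by entry.\<close>
    then have "ws \<in> lists (pushforward (arrs Y) F1 ` tangent_space (arrs X) p)"
      using ws by (auto simp: tangent_tuples_def)
    then obtain vs where vs: "vs \<in> lists (tangent_space (arrs X) p)"
        "ws = map (pushforward (arrs Y) F1) vs"
      unfolding lists_image by blast
    \<comment> \<open>Stated for any pair \<open>f\<close>, \<open>f'\<close> commuting with
      \<open>F1\<close> and \<open>F0\<close>, so that one argument serves source and
      target.\<close>
    have lift: "horizontal_form Y HY (pullback (objs Y) f \<omega>) q ws =
        horizontal_form X HX (pullback (objs X) f' (pullback (objs Y) F0 \<omega>)) p vs"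
      if f: "smooth_map (arrs Y) (objs Y) f" "smooth_map (arrs X) (objs X) f'"
        and comm: "\<And>g. g \<in> carr (arrs X) \<Longrightarrow> f (F1 g) = F0 (f' g)" for f f'
    proof -
      \<comment> \<open>Compatibility moves the projection inside \<open>F1\<close>; the commuting
        square then exchanges \<open>f\<close> after \<open>F1\<close> for \<open>F0\<close> after
        \<open>f'\<close>.\<close>
      have "pushforward (objs Y) f (horizontal Y HY q (pushforward (arrs Y) F1 v)) =
          pushforward (objs Y) F0 (pushforward (objs X) f' (horizontal X HX p v))"
        if "v \<in> set vs" for v
      proof -
        have v: "v \<in> tangent_space (arrs X) p"
          using that vs by auto
        then have "horizontal Y HY q (pushforward (arrs Y) F1 v) =
            pushforward (arrs Y) F1 (horizontal X HX p v)"
          using assms(6) p by (auto simp: compatible_with_connections_def)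
        then show ?thesis
          using pushforward_square[OF manifolds(2,4,1,3) F(1) f F(2) comm p(1)
              horizontal_in_tangent_space[OF conn p(1) v]] by simp
      qed
      then have "map (pushforward (objs Y) f) (map (horizontal Y HY q) ws) =
          map (pushforward (objs Y) F0) (map (pushforward (objs X) f') (map (horizontal X HX p) vs))"
        using vs(2) by simp
      \<comment> \<open>The two evaluations of the form must also have the same base point.\<close>
      moreover have "f q = F0 (f' p)"
        using comm p by blast
      ultimately show ?thesis
        by (simp add: horizontal_form_def pullback_def o_assoc)
    qed
    have "vs \<in> tangent_tuples (arrs X) k p"
      using vs ws by (auto simp: tangent_tuples_def)
    then have "horizontal_form X HX (pullback (objs X) (src X) (pullback (objs Y) F0 \<omega>)) p vs =
        horizontal_form X HX (pullback (objs X) (tgt X) (pullback (objs Y) F0 \<omega>)) p vs"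
      using assms(10) p(1) by (auto simp: groupoid_form_def forms_eq_def)
    then show ?thesis
      using lift[OF maps(3,1) src] lift[OF maps(4,2) tgt] by simp
  qed
  then show ?thesis
    using assms(7) by (simp add: groupoid_form_def forms_eq_def)
qed

end
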